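(* Let $R$ be a proper $*$-ring and let $a\in R$ be central Drazin invertible, with central Drazin inverse $a^{\mathrm{cd}}$ and with Drazin index $k$. If $a^k$ has a $\{1,3\}$-inverse $(a^k)^{(1,3)}$, then $a^{\boxminus}=a^{\mathrm{cd}}a^k(a^k)^{(1,3)}$ (that is, $a$ is central weak core invertible with this central weak core inverse). Moreover, $aa^{\boxminus}=a^k(a^k)^{(1,3)}$.
   Context: A proper $*$-ring is a (not necessarily commutative) ring $R$ with unit $1\ne 0$ and an involution $r\mapsto r^*$ satisfying $(r^* )^*=r$, $(r+s)^*=r^*+s^*$, $(rs)^*=s^*r^*$, such that $r^*r=0$ implies $r=0$. $C(R)$ denotes the center of $R$. A $\{1,3\}$-inverse of $b\in R$ is an element $z=b^{(1,3)}$ with $bzb=b$ and $(bz)^*=bz$. The Drazin inverse of $a$ is the (unique, if it exists) $z\in R$ with $zaz=z$, $az=za$ and $za^{k+1}=a^k$ for some positive integer $k$; the smallest such positive integer $k$ is the Drazin index of $a$. The central Drazin inverse $a^{\mathrm{cd}}$ of $a$ is an element $y\in R$ with $ya\in C(R)$, $yay=y$ and $a^{k+1}y=a^k$ for some positive integer $k$; if it exists, $a$ is called central Drazin invertible. (A central Drazin inverse commutes with $a$, hence is the Drazin inverse of $a$.) A central weak core inverse of $a\in R$ is an element $x\in R$ with $ax\in C(R)$, $xa^{k+1}=a^k$ for some integer $k\ge 1$, $xax=x$ and $(ax)^*=ax$. It is unique if it exists and is denoted $a^{\boxminus}$; $a$ is then called central weak core invertible. *)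

theory Defs
  imports Main
begin

class star_ring = ring_1 +
  fixes star :: "'a \<Rightarrow> 'a"
  assumes star_star: "star (star r) = r"
    and star_add: "star (r + s) = star r + star s"
    and star_mult: "star (r * s) = star s * star r"

class proper_star_ring = star_ring +
  assumes star_mult_self_eq_0: "star r * r = 0 \<Longrightarrow> r = 0"

definition center :: "'a::ring_1 set" where
  "center = {c. \<forall>r. c * r = r * c}"

definition is_one_three_inverse :: "'a::star_ring \<Rightarrow> 'a \<Rightarrow> bool" where
  "is_one_three_inverse b z \<longleftrightarrow> b * z * b = b \<and> star (b * z) = b * z"

definition is_drazin_inverse :: "'a::ring_1 \<Rightarrow> 'a \<Rightarrow> bool" where
  "is_drazin_inverse a z \<longleftrightarrow>
     z * a * z = z \<and> a * z = z * a \<and> (\<exists>k\<ge>1. z * a ^ (k + 1) = a ^ k)"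

(* The inverses named by THE below are unique whenever they exist. *)
definition drazin_inverse :: "'a::ring_1 \<Rightarrow> 'a" where
  "drazin_inverse a = (THE z. is_drazin_inverse a z)"

(* Starts at 1, so a unit has Drazin index 1 rather than 0. *)
definition drazin_index :: "'a::ring_1 \<Rightarrow> nat" where
  "drazin_index a = (LEAST k. k \<ge> 1 \<and> drazin_inverse a * a ^ (k + 1) = a ^ k)"

definition is_central_drazin_inverse :: "'a::ring_1 \<Rightarrow> 'a \<Rightarrow> bool" where
  "is_central_drazin_inverse a y \<longleftrightarrow>
     y * a \<in> center \<and> y * a * y = y \<and> (\<exists>k\<ge>1. a ^ (k + 1) * y = a ^ k)"

definition central_drazin_invertible :: "'a::ring_1 \<Rightarrow> bool" where
  "central_drazin_invertible a \<longleftrightarrow> (\<exists>y. is_central_drazin_inverse a y)"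

definition central_drazin_inverse :: "'a::ring_1 \<Rightarrow> 'a" where
  "central_drazin_inverse a = (THE y. is_central_drazin_inverse a y)"

definition is_central_weak_core_inverse :: "'a::star_ring \<Rightarrow> 'a \<Rightarrow> bool" where
  "is_central_weak_core_inverse a x \<longleftrightarrow>
     a * x \<in> center \<and> (\<exists>k\<ge>1. x * a ^ (k + 1) = a ^ k) \<and> x * a * x = x \<and> star (a * x) = a * x"

definition central_weak_core_invertible :: "'a::star_ring \<Rightarrow> bool" where
  "central_weak_core_invertible a \<longleftrightarrow> (\<exists>x. is_central_weak_core_inverse a x)"

definition central_weak_core_inverse :: "'a::star_ring \<Rightarrow> 'a" where
  "central_weak_core_inverse a = (THE x. is_central_weak_core_inverse a x)"

end

theory Submission
  imports Defs
begin

text \<open>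
  Let \<open>y\<close> be the central Drazin inverse of \<open>a\<close>. It commutes with \<open>a\<close>, so \<open>e = a * y\<close> is a central
  idempotent, and \<open>a ^ k * y ^ k = e\<close> and \<open>e * a ^ k = a ^ k\<close> when \<open>k\<close> is the Drazin index.
  In other words, \<open>a ^ k\<close> is a unit of the corner ring \<open>e R\<close>. The idempotent
  \<open>a ^ k * z\<close> of a \<open>{1,3}\<close>-inverse \<open>z\<close> has the same right ideal as \<open>a ^ k\<close>, which is that of \<open>e\<close>;
  as \<open>e\<close> is central, the two idempotents coincide (\<open>one_inverse_projection_eq_central\<close>).
  Hence \<open>e\<close> inherits self-adjointness from \<open>a ^ k * z\<close>, and this is exactly what \<open>y\<close> needs in order
  to be a central weak core inverse. Moreover \<open>y * a ^ k * z = y * e = y\<close>.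

  Conversely, every central weak core inverse of \<open>a\<close> is a Drazin inverse, because a one-sided
  inverse in the corner ring of a central idempotent becomes two-sided once \<open>a\<close> satisfies the
  power condition (\<open>central_weak_core_inverse_imp_drazin\<close>). Drazin inverses are unique, so \<open>y\<close> is
  the only candidate.
\<close>

lemma center_commute: "c \<in> center \<Longrightarrow> c * r = r * c"
  by (simp add: center_def)

text \<open>
  In the corner ring of the central idempotent \<open>u * v\<close>, the product acts as the unit, so one can
  cancel the factors from the inside out.
\<close>

lemma central_idempotent_power_mult:
  fixes u v :: "'a::ring_1"
  assumes central: "u * v \<in> center" and idem: "(u * v) * (u * v) = u * v" and "n \<ge> 1"
  shows "u ^ n * v ^ n = u * v"
  using \<open>n \<ge> 1\<close>
proof (induction n rule: nat_induct_at_least)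
  case base
  show ?case by simp
next
  case (Suc n)
  have "u ^ Suc n * v ^ Suc n = u * (u ^ n * v ^ n) * v"
    by (simp only: power_Suc[of u n] power_Suc2[of v n] mult.assoc)
  also have "\<dots> = u * (u * v) * v" using Suc.IH by simp
  also have "\<dots> = (u * v) * (u * v)"
    using center_commute[OF central, of u] by (metis mult.assoc)
  finally show ?case using idem by simp
qed

text \<open>
  The idempotents \<open>z * a\<close> and \<open>w * a\<close> of two Drazin inverses absorb each other: since
  \<open>z = z ^ (n + 1) * a ^ n\<close> for every \<open>n\<close>, the power condition for \<open>w\<close> gives \<open>z = z * a * w\<close>, and
  symmetrically \<open>w = z * a * w\<close>.
\<close>

lemma drazin_inverse_unique:
  fixes a :: "'a::ring_1"
  assumes z: "is_drazin_inverse a z" and w: "is_drazin_inverse a w"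
  shows "z = w"
proof -
  have zaz: "z * a * z = z" and az: "a * z = z * a"
    using z by (auto simp: is_drazin_inverse_def)
  have waw: "w * a * w = w" and aw: "a * w = w * a"
    using w by (auto simp: is_drazin_inverse_def)
  obtain m where m: "z * a ^ (m + 1) = a ^ m"
    using z by (auto simp: is_drazin_inverse_def)
  obtain n where n: "w * a ^ (n + 1) = a ^ n"
    using w by (auto simp: is_drazin_inverse_def)
  have left: "z ^ Suc j * a ^ j = z" for j
  proof (induction j)
    case (Suc j)
    have "z ^ Suc (Suc j) * a ^ Suc j = z * (z ^ Suc j * a ^ j) * a"
      by (simp only: power_Suc[of z "Suc j"] power_Suc2[of a j] mult.assoc)
    also have "\<dots> = z * (z * a)" unfolding Suc.IH by (simp add: mult.assoc)
    also have "\<dots> = z" unfolding az[symmetric] using zaz by (simp add: mult.assoc)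
    finally show ?case .
  qed simp
  have right: "a ^ j * w ^ Suc j = w" for j
  proof (induction j)
    case (Suc j)
    have "a ^ Suc j * w ^ Suc (Suc j) = a * (a ^ j * w ^ Suc j) * w"
      by (simp only: power_Suc[of a j] power_Suc2[of w "Suc j"] mult.assoc)
    then show ?case using Suc.IH waw aw by simp
  qed simp
  have n': "a ^ n = a ^ n * (a * w)"
  proof -
    have "w * a ^ j = a ^ j * w" for j
      by (metis aw power_commuting_commutes)
    then have "w * a ^ (n + 1) = a ^ (n + 1) * w" .
    then show ?thesis using n by (metis Suc_eq_plus1 mult.assoc power_Suc2)
  qed
  have "z = z ^ Suc n * a ^ n" using left by simp
  also have "\<dots> = z ^ Suc n * a ^ n * (a * w)"
    by (subst n') (simp add: mult.assoc)
  also have "\<dots> = z * (a * w)" using left by simp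
  finally have 1: "z = z * (a * w)" .
  have "w = a ^ m * w ^ Suc m" using right by simp
  also have "\<dots> = z * a * (a ^ m * w ^ Suc m)"
    by (subst m[symmetric]) (simp add: mult.assoc)
  also have "\<dots> = z * a * w" using right by simp
  finally show ?thesis using 1 by (simp add: mult.assoc)
qed

text \<open>
  The product \<open>y * a\<close> is a central idempotent whose corner ring contains \<open>y\<close> as a left inverse
  of \<open>a\<close>; there \<open>a ^ k\<close> can be cancelled from the left in \<open>a ^ (k + 1) * y = a ^ k\<close>, so that \<open>y\<close>
  is a right inverse as well.
\<close>

lemma central_drazin_inverse_commute:
  assumes "is_central_drazin_inverse a y"
  shows "a * y = y * a"
proof -
  have central: "y * a \<in> center" and yay: "y * a * y = y"
    using assms by (auto simp: is_central_drazin_inverse_def)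
  obtain k where "k \<ge> 1" and k: "a ^ (k + 1) * y = a ^ k"
    using assms by (auto simp: is_central_drazin_inverse_def)
  have idem: "(y * a) * (y * a) = y * a" using yay by (metis mult.assoc)
  have pow: "y ^ k * a ^ k = y * a"
    using central idem \<open>k \<ge> 1\<close> by (rule central_idempotent_power_mult)
  have "a * y = a * (y * a) * y" using yay by (simp add: mult.assoc)
  also have "\<dots> = (y * a) * (a * y)"
    using center_commute[OF central, of a] by (metis mult.assoc)
  also have "\<dots> = y ^ k * (a ^ (k + 1) * y)"
    unfolding pow[symmetric] by (simp only: Suc_eq_plus1[symmetric] power_Suc2 mult.assoc)
  also have "\<dots> = y * a" using k pow by simp
  finally show ?thesis .
qed

lemma central_drazin_inverse_imp_drazin:
  assumes "is_central_drazin_inverse a y"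
  shows "is_drazin_inverse a y"
proof -
  note comm = central_drazin_inverse_commute[OF assms]
  have "y * a ^ n = a ^ n * y" for n
    by (metis comm power_commuting_commutes)
  then show ?thesis
    using assms comm by (metis is_central_drazin_inverse_def is_drazin_inverse_def)
qed

text \<open>
  This is the mirror image of the argument for central Drazin inverses: here \<open>x\<close> is a right
  inverse of \<open>a\<close> in the corner ring of \<open>a * x\<close>, and \<open>a ^ k\<close> is cancelled from the right. Through it,
  uniqueness of central weak core inverses reduces to uniqueness of Drazin inverses.
\<close>

lemma central_weak_core_inverse_imp_drazin:
  assumes "is_central_weak_core_inverse a x"
  shows "is_drazin_inverse a x"
proof -
  have central: "a * x \<in> center" and xax: "x * a * x = x"
    using assms by (auto simp: is_central_weak_core_inverse_def)
  obtain k where "k \<ge> 1" and k: "x * a ^ (k + 1) = a ^ k"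
    using assms by (auto simp: is_central_weak_core_inverse_def)
  have idem: "(a * x) * (a * x) = a * x" using xax by (simp add: mult.assoc)
  have pow: "a ^ k * x ^ k = a * x"
    using central idem \<open>k \<ge> 1\<close> by (rule central_idempotent_power_mult)
  have "x * a = x * (a * x) * a" using xax by (simp add: mult.assoc)
  also have "\<dots> = (x * a) * (a * x)"
    using center_commute[OF central, of a] by (metis mult.assoc)
  also have "\<dots> = (x * a ^ (k + 1)) * x ^ k"
    unfolding pow[symmetric] by (simp add: mult.assoc)
  also have "\<dots> = a * x" using k pow by simp
  finally have "a * x = x * a" by simp
  then show ?thesis using \<open>k \<ge> 1\<close> k xax by (auto simp: is_drazin_inverse_def)
qed

text \<open>
  Both \<open>b * z\<close> and the central element \<open>b * c\<close> act as left identities on \<open>b\<close>, hence on each other;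
  centrality of \<open>b * c\<close> then forces them to agree.
\<close>

lemma one_inverse_projection_eq_central:
  fixes b c z :: "'a::ring_1"
  assumes "b * z * b = b" and "b * c \<in> center" and "b * c * b = b"
  shows "b * z = b * c"
proof -
  have "b * z = (b * c) * (b * z)" using assms(3) by (simp flip: mult.assoc)
  also have "\<dots> = (b * z) * (b * c)" using assms(2) by (rule center_commute)
  also have "\<dots> = b * c" using assms(1) by (simp flip: mult.assoc)
  finally show ?thesis .
qed

theorem theorem4p13:
  fixes a z :: "'a::proper_star_ring" and k :: nat
  assumes "central_drazin_invertible a"
    and "k = drazin_index a"
    and "is_one_three_inverse (a ^ k) z"
  shows "central_weak_core_invertible a
       \<and> central_weak_core_inverse a = central_drazin_inverse a * a ^ k * z
       \<and> a * central_weak_core_inverse a = a ^ k * z"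
proof -
  obtain y where y: "is_central_drazin_inverse a y"
    using assms(1) by (auto simp: central_drazin_invertible_def)
  then have drazin: "is_drazin_inverse a y" by (rule central_drazin_inverse_imp_drazin)
  have comm: "a * y = y * a" using y by (rule central_drazin_inverse_commute)
  have yay: "y * a * y = y" and central: "a * y \<in> center"
    using y comm by (auto simp: is_central_drazin_inverse_def)
  have cd: "central_drazin_inverse a = y"
    unfolding central_drazin_inverse_def
    using y drazin
    by (blast intro: the_equality drazin_inverse_unique central_drazin_inverse_imp_drazin)
  have d: "drazin_inverse a = y"
    unfolding drazin_inverse_def
    using drazin by (blast intro: the_equality drazin_inverse_unique)
  have "\<exists>j. j \<ge> 1 \<and> drazin_inverse a * a ^ (j + 1) = a ^ j"
    using drazin by (auto simp: d is_drazin_inverse_def)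
  then have "k \<ge> 1 \<and> drazin_inverse a * a ^ (k + 1) = a ^ k"
    unfolding assms(2) drazin_index_def by (rule LeastI_ex)
  then have k1: "k \<ge> 1" and k: "y * a ^ (k + 1) = a ^ k" by (simp_all add: d)

  have idem: "(a * y) * (a * y) = a * y" using yay by (simp add: mult.assoc)
  have pow: "a ^ k * y ^ k = a * y"
    using central idem k1 by (rule central_idempotent_power_mult)
  have "a * y * a ^ k = a ^ k" using k comm by (simp add: mult.assoc)
  then have proj: "a ^ k * z = a * y"
    using one_inverse_projection_eq_central[of "a ^ k" z "y ^ k"] assms(3) central
    by (simp add: pow is_one_three_inverse_def)
  have "star (a * y) = a * y"
    using assms(3) by (simp add: is_one_three_inverse_def proj)
  then have wc: "is_central_weak_core_inverse a y"
    using central yay k k1 by (auto simp: is_central_weak_core_inverse_def)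
  then have "central_weak_core_inverse a = y"
    unfolding central_weak_core_inverse_def
    by (blast intro: the_equality drazin_inverse_unique central_weak_core_inverse_imp_drazin)
  moreover have "y * a ^ k * z = y" using proj yay by (simp add: mult.assoc)
  ultimately show ?thesis
    using wc cd proj by (auto simp: central_weak_core_invertible_def)
qed

end
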